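(* Let $0<\alpha\le1$, $\lambda\in\mathbb{C}$, and $\mu>0$. For every $f(z)=z+\sum_{n=2}^{\infty}a_nz^n$ in $\mathcal{S}_{ex}^{\ast}$ (the class with parameter $\alpha$), \[ \mathcal{B}_L\le |a_3-\lambda a_2^2|-\mu|a_2|\le \mathcal{B}_U, \] where \[ \mathcal{B}_U= \begin{cases} \dfrac{\alpha}{2}, & \alpha|3-4\lambda|<2+4\mu,\\[6pt] \dfrac{\alpha^2|3-4\lambda|-4\alpha\mu}{4}, & \alpha|3-4\lambda|\ge 2+4\mu, \end{cases} \] and \[ \mathcal{B}_L= \begin{cases} -\dfrac{\alpha}{4}\bigl(4\mu-\alpha|3-4\lambda|\bigr), & \alpha|3-4\lambda|\le 2\mu-2,\\[8pt] -\alpha\mu\sqrt{\dfrac{2}{\alpha|3-4\lambda|+2}}, & \alpha|3-4\lambda|\ge 2\mu^2-2,\\[8pt] -\dfrac{\alpha}{2}-\dfrac{\alpha\mu^2}{\alpha|3-4\lambda|+2}, & 2\mu-2<\alpha|3-4\lambda|<2\mu^2-2, \end{cases} \] whenever the corresponding region is nonempty. All bounds are sharp: for each admissible $\alpha,\lambda,\mu$ there is a function in $\mathcal{S}_{ex}^{\ast}$ for which $|a_3-\lambda a_2^2|-\mu|a_2|=\mathcal{B}_U$ and a function in $\mathcal{S}_{ex}^{\ast}$ for which $|a_3-\lambda a_2^2|-\mu|a_2|=\mathcal{B}_L$.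
   Context: Let $\mathbb{D}=\{z\in\mathbb{C}:|z|<1\}$. Let $\mathcal{A}$ be the class of analytic functions $f$ in $\mathbb{D}$ of the form $f(z)=z+\sum_{n=2}^{\infty}a_nz^n$. For analytic $F,G$ in $\mathbb{D}$, $F\prec G$ ($F$ is subordinate to $G$) means that there is an analytic $\omega:\mathbb{D}\to\mathbb{D}$ with $\omega(0)=0$ and $F(z)=G(\omega(z))$ for $z\in\mathbb{D}$. For $0<\alpha\le1$, $\mathcal{S}_{ex}^{\ast}$ is the class of all $f\in\mathcal{A}$ such that $\frac{zf'(z)}{f(z)}\prec e^{\alpha z}$ in $\mathbb{D}$ (the quotient being given the value $1$ at $z=0$). *)

theory Defs
  imports "HOL-Complex_Analysis.Complex_Analysis"
begin

abbreviation unit_disc :: "complex set" where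
  "unit_disc \<equiv> ball 0 1"

definition taylor_coeff :: "(complex \<Rightarrow> complex) \<Rightarrow> nat \<Rightarrow> complex" where
  "taylor_coeff f n = fps_nth (fps_expansion f 0) n"

text \<open>
  Analytic functions on the disc are represented by total functions; their values outside the
  disc are irrelevant.
\<close>

definition class_A :: "(complex \<Rightarrow> complex) set" where
  "class_A = {f. f holomorphic_on unit_disc \<and>
     (\<forall>z\<in>unit_disc. (\<lambda>n. taylor_coeff f (n + 2) * z ^ (n + 2)) sums (f z - z))}"

definition subordinate :: "(complex \<Rightarrow> complex) \<Rightarrow> (complex \<Rightarrow> complex) \<Rightarrow> bool"
    (infix \<open>\<prec>\<^sub>D\<close> 50) where
  "F \<prec>\<^sub>D G \<longleftrightarrow> F holomorphic_on unit_disc \<and> G holomorphic_on unit_disc \<and>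
     (\<exists>\<omega>. \<omega> holomorphic_on unit_disc \<and> \<omega> ` unit_disc \<subseteq> unit_disc \<and> \<omega> 0 = 0 \<and>
        (\<forall>z\<in>unit_disc. F z = G (\<omega> z)))"

text \<open>
  No separate condition \<open>f z \<noteq> 0\<close> is needed for \<open>z \<noteq> 0\<close>: a zero of \<open>f\<close> would make the HOL
  quotient \<open>0\<close>, which is not a value of the exponential function.
\<close>

definition class_S_ex :: "real \<Rightarrow> (complex \<Rightarrow> complex) set" where
  "class_S_ex \<alpha> = {f \<in> class_A.
     (\<lambda>z. if z = 0 then 1 else z * deriv f z / f z) \<prec>\<^sub>D (\<lambda>z. exp (of_real \<alpha> * z))}"

definition B_U :: "real \<Rightarrow> complex \<Rightarrow> real \<Rightarrow> real" where
  "B_U \<alpha> l \<mu> =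
     (if \<alpha> * cmod (3 - 4 * l) < 2 + 4 * \<mu> then \<alpha> / 2
      else (\<alpha>\<^sup>2 * cmod (3 - 4 * l) - 4 * \<alpha> * \<mu>) / 4)"

definition B_L :: "real \<Rightarrow> complex \<Rightarrow> real \<Rightarrow> real" where
  "B_L \<alpha> l \<mu> =
     (if \<alpha> * cmod (3 - 4 * l) \<le> 2 * \<mu> - 2
        then - (\<alpha> / 4) * (4 * \<mu> - \<alpha> * cmod (3 - 4 * l))
      else if \<alpha> * cmod (3 - 4 * l) \<ge> 2 * \<mu>\<^sup>2 - 2
        then - \<alpha> * \<mu> * sqrt (2 / (\<alpha> * cmod (3 - 4 * l) + 2))
      else - (\<alpha> / 2) - \<alpha> * \<mu>\<^sup>2 / (\<alpha> * cmod (3 - 4 * l) + 2))"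

text \<open>
  The first two regions of \<open>B_L\<close> overlap when \<open>\<mu> = 1\<close> and \<open>l = 3/4\<close>. Both expressions
  are \<open>- \<alpha>\<close> there, so the nested conditional agrees with the piecewise formula on every region.
\<close>

lemma B_L_cases:
  assumes "0 < \<alpha>" "0 < \<mu>"
  shows "\<alpha> * cmod (3 - 4 * l) \<le> 2 * \<mu> - 2 \<Longrightarrow>
           B_L \<alpha> l \<mu> = - (\<alpha> / 4) * (4 * \<mu> - \<alpha> * cmod (3 - 4 * l))"
    and "\<alpha> * cmod (3 - 4 * l) \<ge> 2 * \<mu>\<^sup>2 - 2 \<Longrightarrow>
           B_L \<alpha> l \<mu> = - \<alpha> * \<mu> * sqrt (2 / (\<alpha> * cmod (3 - 4 * l) + 2))"
    and "2 * \<mu> - 2 < \<alpha> * cmod (3 - 4 * l) \<Longrightarrow> \<alpha> * cmod (3 - 4 * l) < 2 * \<mu>\<^sup>2 - 2 \<Longrightarrow>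
           B_L \<alpha> l \<mu> = - (\<alpha> / 2) - \<alpha> * \<mu>\<^sup>2 / (\<alpha> * cmod (3 - 4 * l) + 2)"
proof -
  let ?K = "\<alpha> * cmod (3 - 4 * l)"
  have overlap: "\<mu> = 1 \<and> ?K = 0" if "?K \<le> 2 * \<mu> - 2" "?K \<ge> 2 * \<mu>\<^sup>2 - 2"
  proof -
    have "?K \<ge> 0" using assms by simp
    then have "\<mu> \<ge> 1" using that by linarith
    have "\<mu> * \<mu> \<le> \<mu> * 1" using that by (simp add: power2_eq_square)
    then have "\<mu> \<le> 1" using assms(2) by (simp only: mult_le_cancel_left_pos)
    then show ?thesis using \<open>\<mu> \<ge> 1\<close> \<open>?K \<ge> 0\<close> that by simp
  qed
  show "?K \<le> 2 * \<mu> - 2 \<Longrightarrow> B_L \<alpha> l \<mu> = - (\<alpha> / 4) * (4 * \<mu> - ?K)"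
    by (simp add: B_L_def)
  show "B_L \<alpha> l \<mu> = - \<alpha> * \<mu> * sqrt (2 / (?K + 2))" if second: "?K \<ge> 2 * \<mu>\<^sup>2 - 2"
  proof (cases "?K \<le> 2 * \<mu> - 2")
    case True
    with second overlap have "\<mu> = 1" and K: "?K = 0" by blast+
    then show ?thesis unfolding B_L_def K by simp
  next
    case False
    with second show ?thesis by (simp add: B_L_def)
  qed
  show "2 * \<mu> - 2 < ?K \<Longrightarrow> ?K < 2 * \<mu>\<^sup>2 - 2 \<Longrightarrow>
      B_L \<alpha> l \<mu> = - (\<alpha> / 2) - \<alpha> * \<mu>\<^sup>2 / (?K + 2)"
    by (simp add: B_L_def)
qed

end

theory Submission
  imports Defs
begin

text \<open>
  Write the subordinating function as \<open>\<omega>(z) = z \<phi>(z)\<close> with \<open>|\<phi>| \<le> 1\<close>, and put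
  \<open>c = \<phi>(0)\<close>, \<open>d = \<phi>'(0)\<close>. Comparing coefficients in
  \<open>z f'(z) = f(z) exp(\<alpha> z \<phi>(z))\<close> gives \<open>a\<^sub>2 = \<alpha> c\<close> and
  \<open>a\<^sub>3 = \<alpha> d / 2 + 3 \<alpha>\<^sup>2 c\<^sup>2 / 4\<close>
  (\<open>taylor_coeffs_from_log_derivative\<close>), so that
  \<open>|a\<^sub>3 - l a\<^sub>2\<^sup>2| - \<mu> |a\<^sub>2| = (\<alpha> / 2) |d + \<alpha> (3 - 4 l) c\<^sup>2 / 2| - \<mu> \<alpha> |c|\<close>.

  By the Schwarz--Pick inequality at the origin (\<open>disc_bounded_deriv_0_le\<close>),
  \<open>|d| \<le> 1 - |c|\<^sup>2\<close>. With \<open>x = |c|\<close> and \<open>K = \<alpha> |3 - 4 l|\<close>, the first modulus lies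
  between \<open>max 0 (K x\<^sup>2 / 2 - (1 - x\<^sup>2))\<close> and \<open>1 - x\<^sup>2 + K x\<^sup>2 / 2\<close>. What remains is to
  maximise, respectively minimise, a piecewise quadratic function of \<open>x\<close> over \<open>[0, 1]\<close>
  (\<open>B_U_upper\<close>, \<open>B_L_lower\<close>). The three forms of the lower bound come from the place of the
  minimum: the endpoint \<open>x = 1\<close>, the kink where \<open>(K + 2) x\<^sup>2 = 2\<close>, or the vertex
  \<open>x = 2 \<mu> / (K + 2)\<close> of the parabola to the right of that kink.

  For sharpness, the functions \<open>\<phi>(z) = (x + \<eta> z) / (1 + x \<eta> z)\<close> with \<open>|\<eta>| = 1\<close>
  realise \<open>c = x\<close> and \<open>d = \<eta> (1 - x\<^sup>2)\<close>. Every such \<open>\<phi>\<close> comes from a function of the class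
  (\<open>log_derivative_solution_exists\<close>). Choosing \<open>\<eta>\<close> so that \<open>d\<close> points against
  \<open>(3 - 4 l) c\<^sup>2\<close> serves all the extremal cases at once
  (\<open>class_S_ex_functional_attained\<close>): at the upper extrema \<open>x = 0\<close> or \<open>x = 1\<close> one of the two
  summands vanishes, so its direction does not matter there.
\<close>

section \<open>Bounded functions on the disc\<close>

text \<open>
  The disc automorphism that takes \<open>\<phi> 0\<close> to \<open>0\<close> has derivative \<open>1 / (1 - |\<phi> 0|\<^sup>2)\<close> at
  \<open>\<phi> 0\<close>, and the Schwarz lemma bounds the derivative of the composition by \<open>1\<close>. If \<open>|\<phi>|\<close>
  reaches \<open>1\<close> inside the disc, \<open>\<phi>\<close> is constant by the maximum modulus principle.
\<close>

lemma disc_bounded_deriv_0_le: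
  assumes hol: "\<phi> holomorphic_on unit_disc"
    and bound: "\<And>z. z \<in> unit_disc \<Longrightarrow> cmod (\<phi> z) \<le> 1"
  shows "cmod (deriv \<phi> 0) \<le> 1 - (cmod (\<phi> 0))\<^sup>2"
proof (cases "\<exists>w\<in>unit_disc. cmod (\<phi> w) = 1")
  case True
  then obtain w where w: "w \<in> unit_disc" "cmod (\<phi> w) = 1" by blast
  have "\<phi> constant_on unit_disc"
    by (rule maximum_modulus_principle[OF hol, of unit_disc w]) (use w bound in auto)
  then obtain c where c: "\<And>z. z \<in> unit_disc \<Longrightarrow> \<phi> z = c"
    by (auto simp: constant_on_def)
  have "eventually (\<lambda>z. z \<in> unit_disc) (nhds (0::complex))"
    by (intro eventually_nhds_in_open) auto
  then have "eventually (\<lambda>z. \<phi> z = c) (nhds 0)"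
    by eventually_elim (rule c)
  then have "deriv \<phi> 0 = deriv (\<lambda>_. c) 0"
    by (intro deriv_cong_ev) auto
  then show ?thesis using bound[of 0] by (simp add: power_le_one)
next
  case False
  then have lt: "cmod (\<phi> z) < 1" if "z \<in> unit_disc" for z
    using bound[OF that] that by force
  define a where "a = \<phi> 0"
  have a: "cmod a < 1" using lt[of 0] by (simp add: a_def)
  define \<psi> where "\<psi> = Moebius_function 0 a \<circ> \<phi>"
  have "\<psi> holomorphic_on unit_disc"
    unfolding \<psi>_def
    by (rule holomorphic_on_compose_gen[OF hol Moebius_function_holomorphic[OF a]])
      (use lt in auto)
  moreover have "\<psi> 0 = 0"
    by (simp add: \<psi>_def a_def Moebius_function_eq_zero)
  moreover have "cmod (\<psi> z) < 1" if "cmod z < 1" for z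
    using Moebius_function_norm_lt_1[OF a] lt[of z] that by (simp add: \<psi>_def)
  ultimately have le: "cmod (deriv \<psi> 0) \<le> 1"
    using Schwarz_Lemma' by blast
  have a2: "(cmod a)\<^sup>2 < 1"
    using a by (simp add: abs_square_less_1)
  have nz: "1 - cnj a * a \<noteq> 0"
  proof
    assume "1 - cnj a * a = 0"
    then have "cmod (cnj a * a) = 1" by simp
    then show False using a2 by (simp add: norm_mult power2_eq_square)
  qed
  have d\<phi>: "(\<phi> has_field_derivative deriv \<phi> 0) (at 0)"
    by (rule holomorphic_derivI[OF hol]) auto
  have "(\<psi> has_field_derivative
          (deriv \<phi> 0 * (1 - cnj a * a) - (a - a) * (- (cnj a * deriv \<phi> 0)))
            / ((1 - cnj a * a) * (1 - cnj a * a))) (at 0)"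
    unfolding \<psi>_def o_def Moebius_function_simple
    by (rule derivative_eq_intros d\<phi> refl | use nz in \<open>simp add: a_def\<close>)+
  then have "deriv \<psi> 0 = deriv \<phi> 0 / (1 - cnj a * a)"
    using nz by (auto dest!: DERIV_imp_deriv simp: divide_simps)
  moreover have "1 - cnj a * a = of_real (1 - (cmod a)\<^sup>2)"
    by (metis complex_norm_square mult.commute of_real_1 of_real_diff)
  ultimately have "cmod (deriv \<psi> 0) = cmod (deriv \<phi> 0) / \<bar>1 - (cmod a)\<^sup>2\<bar>"
    by (simp only: norm_divide norm_of_real)
  then have "cmod (deriv \<phi> 0) = cmod (deriv \<psi> 0) * (1 - (cmod a)\<^sup>2)"
    using a2 by (simp add: divide_simps)
  also have "\<dots> \<le> 1 * (1 - (cmod a)\<^sup>2)"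
    using le a2 by (intro mult_right_mono) auto
  finally show ?thesis by (simp add: a_def)
qed

lemma disc_self_map_fixing_0_factor:
  assumes hol: "\<omega> holomorphic_on unit_disc" and self: "\<omega> ` unit_disc \<subseteq> unit_disc"
    and zero: "\<omega> 0 = 0"
  obtains \<phi> where "\<phi> holomorphic_on unit_disc" "\<And>z. z \<in> unit_disc \<Longrightarrow> cmod (\<phi> z) \<le> 1"
    "\<And>z. z \<in> unit_disc \<Longrightarrow> \<omega> z = z * \<phi> z"
proof -
  obtain \<phi> where \<phi>: "\<phi> holomorphic_on unit_disc" "\<And>z. cmod z < 1 \<Longrightarrow> \<omega> z = z * \<phi> z"
    "deriv \<omega> 0 = \<phi> 0"
    using Schwarz3[OF hol zero] by blast
  have lt: "cmod (\<omega> z) < 1" if "cmod z < 1" for z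
    using self that by (force simp: image_subset_iff)
  note schwarz = Schwarz_Lemma'[OF hol zero lt]
  have "cmod (\<phi> z) \<le> 1" if z: "z \<in> unit_disc" for z
  proof (cases "z = 0")
    case True
    then show ?thesis using schwarz \<phi>(3) by simp
  next
    case False
    have "cmod (\<omega> z) \<le> cmod z" using schwarz z by auto
    then have "cmod z * cmod (\<phi> z) \<le> cmod z"
      using z \<phi>(2)[of z] by (simp add: norm_mult)
    then show ?thesis using False by simp
  qed
  then show ?thesis using that \<phi> by simp
qed

text \<open>
  These functions give equality in the Schwarz--Pick inequality at the origin. The value
  \<open>x = 1\<close> is included: the quotient is then the constant \<open>1\<close>.
\<close>

lemma disc_moebius_exists:
  assumes x: "0 \<le> x" "x \<le> 1" and \<eta>: "cmod \<eta> = 1"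
  obtains \<phi> where "\<phi> holomorphic_on unit_disc" "\<And>z. z \<in> unit_disc \<Longrightarrow> cmod (\<phi> z) \<le> 1"
    "\<phi> 0 = of_real x" "deriv \<phi> 0 = \<eta> * of_real (1 - x\<^sup>2)"
proof -
  define \<phi> where "\<phi> z = (of_real x + \<eta> * z) / (1 + of_real x * (\<eta> * z))" for z
  have nz: "1 + of_real x * (\<eta> * z) \<noteq> 0" if "z \<in> unit_disc" for z
  proof
    assume "1 + of_real x * (\<eta> * z) = 0"
    then have "cmod (of_real x * (\<eta> * z)) = 1"
      by (metis add.inverse_inverse add_eq_0_iff norm_minus_cancel norm_one)
    then have "x * cmod z = 1" using x \<eta> by (simp add: norm_mult)
    moreover have "x * cmod z \<le> 1 * cmod z" using x by (intro mult_right_mono) auto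
    ultimately show False using that by simp
  qed
  have "\<phi> holomorphic_on unit_disc"
    unfolding \<phi>_def by (intro holomorphic_intros) (use nz in auto)
  moreover have "cmod (\<phi> z) \<le> 1" if z: "z \<in> unit_disc" for z
  proof -
    define w where "w = \<eta> * z"
    have w: "cmod w < 1" using z \<eta> by (simp add: w_def norm_mult)
    have "(cmod (1 + of_real x * w))\<^sup>2 - (cmod (of_real x + w))\<^sup>2
        = (1 - x\<^sup>2) * (1 - (cmod w)\<^sup>2)"
      unfolding cmod_power2 by (simp add: power2_eq_square algebra_simps)
    moreover have "0 \<le> (1 - x\<^sup>2) * (1 - (cmod w)\<^sup>2)"
      using x w by (intro mult_nonneg_nonneg) (auto simp: power_le_one)
    ultimately have "(cmod (of_real x + w))\<^sup>2 \<le> (cmod (1 + of_real x * w))\<^sup>2" by linarith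
    then have "cmod (of_real x + w) \<le> cmod (1 + of_real x * w)"
      by (rule power2_le_imp_le) simp
    then show ?thesis
      using nz[OF z] by (simp add: \<phi>_def w_def norm_divide divide_le_eq_1)
  qed
  moreover have "\<phi> 0 = of_real x" by (simp add: \<phi>_def)
  moreover have "(\<phi> has_field_derivative \<eta> * of_real (1 - x\<^sup>2)) (at 0)"
    unfolding \<phi>_def
    by (rule derivative_eq_intros refl | simp add: power2_eq_square algebra_simps)+
  then have "deriv \<phi> 0 = \<eta> * of_real (1 - x\<^sup>2)" by (rule DERIV_imp_deriv)
  ultimately show ?thesis using that by blast
qed

section \<open>The classes of functions\<close>

lemma taylor_coeff_sums:
  assumes "f holomorphic_on unit_disc" "z \<in> unit_disc"
  shows "(\<lambda>n. taylor_coeff f n * z ^ n) sums f z"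
  using holomorphic_power_series[OF assms] by (simp add: taylor_coeff_def fps_expansion_def)

text \<open>
  The series in the definition of the class is the Taylor series of \<open>f\<close> without its first two
  terms, so it sums to \<open>f z - z\<close> exactly when those terms add up to \<open>z\<close>.
\<close>

lemma class_A_iff:
  "f \<in> class_A \<longleftrightarrow> f holomorphic_on unit_disc \<and> f 0 = 0 \<and> deriv f 0 = 1"
proof (cases "f holomorphic_on unit_disc")
  case True
  have t0: "taylor_coeff f 0 = f 0" and t1: "taylor_coeff f 1 = deriv f 0"
    by (simp_all add: taylor_coeff_def fps_expansion_def)
  have tail: "(\<lambda>n. taylor_coeff f (n + 2) * z ^ (n + 2)) sums (f z - (f 0 + deriv f 0 * z))"
    if "z \<in> unit_disc" for z
    using sums_split_initial_segment[OF taylor_coeff_sums[OF True that], of 2] t1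
    by (simp add: t0 numeral_2_eq_2)
  have "f 0 = 0 \<and> deriv f 0 = 1" if "f \<in> class_A"
  proof -
    have eq: "f 0 + deriv f 0 * z = z" if z: "z \<in> unit_disc" for z
    proof -
      have "(\<lambda>n. taylor_coeff f (n + 2) * z ^ (n + 2)) sums (f z - z)"
        using \<open>f \<in> class_A\<close> z by (auto simp: class_A_def)
      then show ?thesis
        by (rule diff_left_imp_eq[OF sums_unique2[OF tail[OF z]]])
    qed
    \<comment> \<open>An affine function is determined by its values at two points of the disc.\<close>
    show ?thesis using eq[of 0] eq[of "1/2"] by simp
  qed
  moreover have "f \<in> class_A" if "f 0 = 0 \<and> deriv f 0 = 1"
    using tail that True by (simp add: class_A_def)
  ultimately show ?thesis using True by blast
qed (simp add: class_A_def)

text \<open>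
  Dividing the subordinating function by \<open>z\<close> turns the condition \<open>\<omega> 0 = 0\<close> into a mere bound
  \<open>|\<phi>| \<le> 1\<close>, in which \<open>\<phi> 0\<close> and \<open>deriv \<phi> 0\<close> are the first two coefficients of \<open>\<omega>\<close>.
\<close>

lemma class_S_ex_iff:
  "f \<in> class_S_ex \<alpha> \<longleftrightarrow> f \<in> class_A \<and>
    (\<exists>\<phi>. \<phi> holomorphic_on unit_disc \<and> (\<forall>z\<in>unit_disc. cmod (\<phi> z) \<le> 1) \<and>
      (\<forall>z\<in>unit_disc. (if z = 0 then 1 else z * deriv f z / f z) = exp (of_real \<alpha> * (z * \<phi> z))))"
    (is "_ \<longleftrightarrow> _ \<and> ?R")
proof -
  let ?F = "\<lambda>z. if z = 0 then 1 else z * deriv f z / f z"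
  have "?R" if sub: "?F \<prec>\<^sub>D (\<lambda>z. exp (of_real \<alpha> * z))"
  proof -
    obtain \<omega> where \<omega>: "\<omega> holomorphic_on unit_disc" "\<omega> ` unit_disc \<subseteq> unit_disc" "\<omega> 0 = 0"
      "\<forall>z\<in>unit_disc. ?F z = exp (of_real \<alpha> * \<omega> z)"
      using sub unfolding subordinate_def by blast
    obtain \<phi> where "\<phi> holomorphic_on unit_disc" "\<And>z. z \<in> unit_disc \<Longrightarrow> cmod (\<phi> z) \<le> 1"
      "\<And>z. z \<in> unit_disc \<Longrightarrow> \<omega> z = z * \<phi> z"
      using disc_self_map_fixing_0_factor[OF \<omega>(1-3)] by blast
    then show ?thesis using \<omega>(4) by (intro exI[of _ \<phi>]) simp
  qed
  moreover have "?F \<prec>\<^sub>D (\<lambda>z. exp (of_real \<alpha> * z))" if "?R"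
  proof -
    obtain \<phi> where \<phi>: "\<phi> holomorphic_on unit_disc" "\<forall>z\<in>unit_disc. cmod (\<phi> z) \<le> 1"
      "\<forall>z\<in>unit_disc. ?F z = exp (of_real \<alpha> * (z * \<phi> z))"
      using \<open>?R\<close> by blast
    have "(\<lambda>z. exp (of_real \<alpha> * (z * \<phi> z))) holomorphic_on unit_disc"
      by (intro holomorphic_intros \<phi>(1))
    then have "?F holomorphic_on unit_disc"
      by (rule holomorphic_transform) (use \<phi>(3) in auto)
    moreover have "(\<lambda>z. exp (of_real \<alpha> * z)) holomorphic_on unit_disc"
      by (intro holomorphic_intros)
    moreover have "(\<lambda>z. z * \<phi> z) holomorphic_on unit_disc"
      by (intro holomorphic_intros \<phi>(1))
    moreover have "cmod (z * \<phi> z) < 1" if "z \<in> unit_disc" for z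
    proof -
      have "cmod z * cmod (\<phi> z) \<le> cmod z * 1"
        using \<phi>(2) that by (intro mult_left_mono) auto
      then show ?thesis using that by (simp add: norm_mult)
    qed
    ultimately show ?thesis
      unfolding subordinate_def
      by (intro conjI exI[of _ "\<lambda>z. z * \<phi> z"]) (use \<phi>(3) in auto)
  qed
  ultimately show ?thesis unfolding class_S_ex_def by blast
qed

text \<open>
  Two differential equations determine the coefficients recursively: \<open>z f' = f h\<close> for \<open>f\<close>, and
  \<open>h' = a (z \<phi>)' h\<close> for \<open>h = exp (a z \<phi>)\<close>. The second avoids composing power series.
\<close>

lemma taylor_coeffs_from_log_derivative:
  assumes f: "f \<in> class_A" and \<phi>: "\<phi> holomorphic_on unit_disc"
    and eq: "\<And>z. z \<in> unit_disc \<Longrightarrow>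
      (if z = 0 then 1 else z * deriv f z / f z) = exp (a * (z * \<phi> z))"
  shows "taylor_coeff f 2 = a * \<phi> 0"
    and "taylor_coeff f 3 = a * deriv \<phi> 0 / 2 + 3 * a\<^sup>2 * (\<phi> 0)\<^sup>2 / 4"
proof -
  define F P where "F = fps_expansion f 0" and "P = fps_expansion \<phi> 0"
  define h where "h z = exp (a * (z * \<phi> z))" for z
  define H where "H = fps_expansion h 0"
  have holf: "f holomorphic_on unit_disc" and f0: "f 0 = 0" and f1: "deriv f 0 = 1"
    using f by (auto simp: class_A_iff)
  have holh: "h holomorphic_on unit_disc"
    unfolding h_def by (intro holomorphic_intros \<phi>)
  have F: "f has_fps_expansion F"
    unfolding F_def by (rule has_fps_expansion_fps_expansion[OF _ _ holf]) auto
  have P: "\<phi> has_fps_expansion P"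
    unfolding P_def by (rule has_fps_expansion_fps_expansion[OF _ _ \<phi>]) auto
  have H: "h has_fps_expansion H"
    unfolding H_def by (rule has_fps_expansion_fps_expansion[OF _ _ holh]) auto
  have F01: "fps_nth F 0 = 0" "fps_nth F 1 = 1"
    by (simp_all add: F_def fps_expansion_def f0 f1)
  have P01: "fps_nth P 0 = \<phi> 0" "fps_nth P 1 = deriv \<phi> 0"
    by (simp_all add: P_def fps_expansion_def)
  have H0: "fps_nth H 0 = 1"
    by (simp add: H_def fps_expansion_def h_def)
  have near: "eventually (\<lambda>z. z \<in> unit_disc) (nhds (0::complex))"
    by (intro eventually_nhds_in_open) auto
  have "z * deriv f z = f z * h z" if "z \<in> unit_disc" for z
  proof (cases "z = 0")
    case False
    \<comment> \<open>If \<open>f z = 0\<close>, the quotient would be \<open>0\<close>, which is not an exponential.\<close>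
    then have "z * deriv f z / f z = h z" using eq[OF that] by (simp add: h_def)
    moreover from this have "f z \<noteq> 0" by (auto simp: h_def)
    ultimately show ?thesis by (simp add: field_simps)
  qed (simp add: f0)
  then have "eventually (\<lambda>z. z * deriv f z = f z * h z) (nhds 0)"
    using near by (auto elim: eventually_mono)
  note cong_fH = has_fps_expansion_cong[OF this refl]
  have "(\<lambda>z. z * deriv f z) has_fps_expansion fps_X * fps_deriv F"
    and "(\<lambda>z. f z * h z) has_fps_expansion F * H"
    by (intro fps_expansion_intros F H)+
  then have FH: "fps_X * fps_deriv F = F * H"
    using fps_expansion_unique_complex cong_fH by metis
  have "deriv h z = a * (\<phi> z + z * deriv \<phi> z) * h z" if "z \<in> unit_disc" for z
  proof -
    have "(\<phi> has_field_derivative deriv \<phi> z) (at z)"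
      by (rule holomorphic_derivI[OF \<phi>]) (use that in auto)
    then have "(h has_field_derivative a * (\<phi> z + z * deriv \<phi> z) * h z) (at z)"
      unfolding h_def by (auto intro!: derivative_eq_intros simp: algebra_simps)
    then show ?thesis by (rule DERIV_imp_deriv)
  qed
  then have "eventually (\<lambda>z. deriv h z = a * (\<phi> z + z * deriv \<phi> z) * h z) (nhds 0)"
    using near by (auto elim: eventually_mono)
  note cong_hP = has_fps_expansion_cong[OF this refl]
  have "(\<lambda>z. a * (\<phi> z + z * deriv \<phi> z) * h z) has_fps_expansion
      fps_const a * (P + fps_X * fps_deriv P) * H"
    and "deriv h has_fps_expansion fps_deriv H"
    by (intro fps_expansion_intros P H)+
  then have HP: "fps_deriv H = fps_const a * (P + fps_X * fps_deriv P) * H"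
    using fps_expansion_unique_complex cong_hP by metis
  have nth2: "fps_nth (A * B) 2 = fps_nth A 0 * fps_nth B 2 + fps_nth A 1 * fps_nth B 1
      + fps_nth A 2 * fps_nth B 0"
    and nth3: "fps_nth (A * B) 3 = fps_nth A 0 * fps_nth B 3 + fps_nth A 1 * fps_nth B 2
      + fps_nth A 2 * fps_nth B 1 + fps_nth A 3 * fps_nth B 0" for A B :: "complex fps"
    by (simp_all add: fps_mult_nth eval_nat_numeral)
  have H1: "fps_nth H 1 = a * \<phi> 0"
    using arg_cong[OF HP, of "\<lambda>S. fps_nth S 0"] P01 H0 by (simp add: mult.assoc)
  have H2: "2 * fps_nth H 2 = 2 * a * deriv \<phi> 0 + a\<^sup>2 * (\<phi> 0)\<^sup>2"
    using arg_cong[OF HP, of "\<lambda>S. fps_nth S 1"] P01 H0 H1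
    by (simp add: fps_mult_nth_1 power2_eq_square algebra_simps flip: numeral_2_eq_2)
  have "2 * fps_nth F 2 = fps_nth F 2 + a * \<phi> 0"
    using arg_cong[OF FH, of "\<lambda>S. fps_nth S 2"] F01 H0 H1
    by (simp add: nth2 flip: numeral_2_eq_2)
  then have F2: "fps_nth F 2 = a * \<phi> 0" by simp
  then show "taylor_coeff f 2 = a * \<phi> 0" by (simp add: taylor_coeff_def F_def)
  have "3 * fps_nth F 3 = fps_nth F 3 + fps_nth F 2 * fps_nth H 1 + fps_nth H 2"
    using arg_cong[OF FH, of "\<lambda>S. fps_nth S 3"] nth3[of F H] F01 H0
    by (simp add: eval_nat_numeral)
  then have "4 * fps_nth F 3 = 2 * (fps_nth F 2 * fps_nth H 1) + 2 * fps_nth H 2"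
    by algebra
  also have "\<dots> = 2 * a * deriv \<phi> 0 + 3 * a\<^sup>2 * (\<phi> 0)\<^sup>2"
    unfolding H1 H2 F2 by (simp add: power2_eq_square algebra_simps)
  finally have "fps_nth F 3 = a * deriv \<phi> 0 / 2 + 3 * a\<^sup>2 * (\<phi> 0)\<^sup>2 / 4"
    by (simp add: field_simps)
  then show "taylor_coeff f 3 = a * deriv \<phi> 0 / 2 + 3 * a\<^sup>2 * (\<phi> 0)\<^sup>2 / 4"
    by (simp add: taylor_coeff_def F_def)
qed

text \<open>
  The equation \<open>z f' / f = exp (a z \<phi>)\<close> says that the logarithmic derivative of \<open>f z / z\<close> is
  \<open>(exp (a z \<phi>) - 1) / z\<close>, whose singularity at \<open>0\<close> is removable. So \<open>f z = z exp (G z)\<close>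
  for the primitive \<open>G\<close> of this function with \<open>G 0 = 0\<close>.
\<close>

lemma log_derivative_solution_exists:
  assumes \<phi>: "\<phi> holomorphic_on unit_disc"
  obtains f where "f \<in> class_A"
    "\<And>z. z \<in> unit_disc \<Longrightarrow>
      (if z = 0 then 1 else z * deriv f z / f z) = exp (a * (z * \<phi> z))"
proof -
  define k where "k z = exp (a * (z * \<phi> z)) - 1" for z
  have "k holomorphic_on unit_disc"
    unfolding k_def by (intro holomorphic_intros \<phi>)
  moreover have "k 0 = 0" by (simp add: k_def)
  ultimately obtain g where g: "g holomorphic_on unit_disc"
    "\<And>z. cmod z < 1 \<Longrightarrow> k z = z * g z"
    using Schwarz3[of k 1] by blast
  obtain G\<^sub>0 where G\<^sub>0: "\<And>z. z \<in> unit_disc \<Longrightarrow> (G\<^sub>0 has_field_derivative g z) (at z within unit_disc)"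
    using holomorphic_convex_primitive'[OF _ _ g(1)] by auto
  define G where "G z = G\<^sub>0 z - G\<^sub>0 0" for z
  have G: "(G has_field_derivative g z) (at z)" if "z \<in> unit_disc" for z
    using G\<^sub>0[OF that] at_within_open[OF that open_ball] unfolding G_def
    by (auto intro!: derivative_eq_intros)
  define f where "f z = z * exp (G z)" for z
  have df: "(f has_field_derivative exp (G z) * (1 + z * g z)) (at z)" if "z \<in> unit_disc" for z
    unfolding f_def
    by (rule derivative_eq_intros G[OF that] refl | simp add: algebra_simps)+
  then have holf: "f holomorphic_on unit_disc"
    by (intro holomorphic_onI) (auto simp: field_differentiable_def intro: DERIV_subset)
  have "f \<in> class_A"
    using holf DERIV_imp_deriv[OF df[of 0]] by (simp add: class_A_iff f_def G_def)
  moreover have "(if z = 0 then 1 else z * deriv f z / f z) = exp (a * (z * \<phi> z))"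
    if z: "z \<in> unit_disc" for z
  proof -
    have "exp (a * (z * \<phi> z)) = 1 + z * g z"
      using g(2)[of z] z by (simp add: k_def algebra_simps)
    then show ?thesis
      using DERIV_imp_deriv[OF df[OF z]] by (simp add: f_def)
  qed
  ultimately show ?thesis using that by blast
qed

section \<open>The initial coefficients\<close>

lemma class_S_ex_coeffs:
  assumes "f \<in> class_S_ex \<alpha>"
  obtains c d where "cmod d \<le> 1 - (cmod c)\<^sup>2"
    "taylor_coeff f 2 = of_real \<alpha> * c"
    "taylor_coeff f 3 = of_real \<alpha> * d / 2 + 3 * (of_real \<alpha>)\<^sup>2 * c\<^sup>2 / 4"
proof -
  obtain \<phi> where A: "f \<in> class_A" and \<phi>: "\<phi> holomorphic_on unit_disc"
    "\<And>z. z \<in> unit_disc \<Longrightarrow> cmod (\<phi> z) \<le> 1"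
    "\<And>z. z \<in> unit_disc \<Longrightarrow>
      (if z = 0 then 1 else z * deriv f z / f z) = exp (of_real \<alpha> * (z * \<phi> z))"
    using assms unfolding class_S_ex_iff by blast
  show ?thesis
    using that[OF disc_bounded_deriv_0_le[OF \<phi>(1,2)]]
      taylor_coeffs_from_log_derivative[OF A \<phi>(1,3)] by blast
qed

lemma class_S_ex_coeffs_attained:
  assumes "0 \<le> x" "x \<le> 1" "cmod \<eta> = 1"
  obtains f where "f \<in> class_S_ex \<alpha>"
    "taylor_coeff f 2 = of_real (\<alpha> * x)"
    "taylor_coeff f 3 = of_real \<alpha> * (\<eta> * of_real (1 - x\<^sup>2)) / 2 + 3 * (of_real \<alpha>)\<^sup>2 * (of_real x)\<^sup>2 / 4"
proof -
  obtain \<phi> where \<phi>: "\<phi> holomorphic_on unit_disc" "\<And>z. z \<in> unit_disc \<Longrightarrow> cmod (\<phi> z) \<le> 1"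
    "\<phi> 0 = of_real x" "deriv \<phi> 0 = \<eta> * of_real (1 - x\<^sup>2)"
    using disc_moebius_exists[OF assms] by blast
  obtain f where f: "f \<in> class_A" "\<And>z. z \<in> unit_disc \<Longrightarrow>
      (if z = 0 then 1 else z * deriv f z / f z) = exp (of_real \<alpha> * (z * \<phi> z))"
    using log_derivative_solution_exists[OF \<phi>(1)] by blast
  have "f \<in> class_S_ex \<alpha>"
    unfolding class_S_ex_iff using f \<phi>(1,2) by blast
  with that taylor_coeffs_from_log_derivative[OF f(1) \<phi>(1) f(2)] \<phi>(3,4)
  show ?thesis by simp
qed

lemma fekete_szego_combination:
  fixes c d l :: complex
  assumes "0 \<le> \<alpha>"
  shows "cmod ((of_real \<alpha> * d / 2 + 3 * (of_real \<alpha>)\<^sup>2 * c\<^sup>2 / 4) - l * (of_real \<alpha> * c)\<^sup>2)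
    = \<alpha> / 2 * cmod (d + of_real \<alpha> * (3 - 4 * l) * c\<^sup>2 / 2)"
proof -
  have "(of_real \<alpha> * d / 2 + 3 * (of_real \<alpha>)\<^sup>2 * c\<^sup>2 / 4) - l * (of_real \<alpha> * c)\<^sup>2
      = of_real (\<alpha> / 2) * (d + of_real \<alpha> * (3 - 4 * l) * c\<^sup>2 / 2)"
    by (simp add: field_simps power2_eq_square)
  then show ?thesis using assms by (simp only: norm_mult norm_of_real)
qed

text \<open>
  The unimodular factor of the extremal function is chosen opposite to \<open>3 - 4 l\<close>, so that the
  two summands of the modulus subtract from each other.
\<close>

lemma class_S_ex_functional_attained:
  assumes "0 \<le> \<alpha>" "0 \<le> x" "x \<le> 1"
  obtains f where "f \<in> class_S_ex \<alpha>"
    "cmod (taylor_coeff f 3 - l * (taylor_coeff f 2)\<^sup>2) - \<mu> * cmod (taylor_coeff f 2)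
      = \<alpha> / 2 * \<bar>\<alpha> * cmod (3 - 4 * l) * x\<^sup>2 / 2 - (1 - x\<^sup>2)\<bar> - \<mu> * (\<alpha> * x)"
proof -
  define v where "v = 3 - 4 * l"
  define \<eta> where "\<eta> = (if v = 0 then 1 else - sgn v)"
  have \<eta>: "cmod \<eta> = 1" by (simp add: \<eta>_def norm_sgn)
  have v: "v = - \<eta> * of_real (cmod v)"
    by (simp add: \<eta>_def sgn_eq)
  obtain f where f: "f \<in> class_S_ex \<alpha>"
    "taylor_coeff f 2 = of_real \<alpha> * of_real x"
    "taylor_coeff f 3 = of_real \<alpha> * (\<eta> * of_real (1 - x\<^sup>2)) / 2 + 3 * (of_real \<alpha>)\<^sup>2 * (of_real x)\<^sup>2 / 4"
    using class_S_ex_coeffs_attained[OF assms(2,3) \<eta>, of \<alpha>] by (metis of_real_mult)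
  have "\<eta> * of_real (1 - x\<^sup>2) + of_real \<alpha> * v * (of_real x)\<^sup>2 / 2
      = - \<eta> * of_real (\<alpha> * cmod v * x\<^sup>2 / 2 - (1 - x\<^sup>2))"
    by (subst v) (simp add: algebra_simps)
  then have "cmod (\<eta> * of_real (1 - x\<^sup>2) + of_real \<alpha> * v * (of_real x)\<^sup>2 / 2)
      = \<bar>\<alpha> * cmod v * x\<^sup>2 / 2 - (1 - x\<^sup>2)\<bar>"
    using \<eta> by (simp only: norm_mult norm_minus_cancel norm_of_real) simp
  then show ?thesis
    using that[OF f(1)] assms f(2) fekete_szego_combination[OF assms(1)]
    unfolding f(2,3) v_def by (simp add: norm_mult)
qed

section \<open>The extremal problem on the unit interval\<close>

text \<open>
  The inequalities compare the quadratic function with its values at \<open>0\<close> and \<open>1\<close>, which are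
  the two candidates for \<open>B_U\<close>.
\<close>

lemma B_U_upper:
  assumes "0 < \<alpha>" "0 < \<mu>" "0 \<le> x" "x \<le> 1"
  shows "\<alpha> / 2 * (1 - x\<^sup>2 + \<alpha> * cmod (3 - 4 * l) * x\<^sup>2 / 2) - \<mu> * (\<alpha> * x) \<le> B_U \<alpha> l \<mu>"
proof -
  define K where "K = \<alpha> * cmod (3 - 4 * l)"
  have xx: "x\<^sup>2 \<le> x" using assms(3,4) by (simp add: power2_eq_square mult_left_le)
  show ?thesis
  proof (cases "K < 2 + 4 * \<mu>")
    case True
    have "(K / 2 - 1) * x\<^sup>2 \<le> 2 * \<mu> * x\<^sup>2" using True by (intro mult_right_mono) auto
    also have "\<dots> \<le> 2 * \<mu> * x" using xx assms(2) by simp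
    finally have "0 \<le> \<alpha> / 2 * (2 * \<mu> * x - (K / 2 - 1) * x\<^sup>2)" using assms(1) by simp
    then show ?thesis
      using True by (simp add: B_U_def flip: K_def) (simp add: algebra_simps)
  next
    case False
    have "2 * \<mu> * (1 - x) \<le> (K / 2 - 1) * (1 - x\<^sup>2)"
      using False xx assms by (intro mult_mono) auto
    then have "0 \<le> \<alpha> / 2 * ((K / 2 - 1) * (1 - x\<^sup>2) - 2 * \<mu> * (1 - x))" using assms(1) by simp
    moreover have "B_U \<alpha> l \<mu> = (\<alpha> * K - 4 * \<alpha> * \<mu>) / 4"
      using False by (simp add: B_U_def K_def power2_eq_square)
    ultimately show ?thesis
      by (simp flip: K_def) (simp add: algebra_simps)
  qed
qed

text \<open>
  In terms of \<open>m = (\<alpha> |3 - 4 l| + 2) / 2\<close>, the quantity to bound below is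
  \<open>(\<alpha> / 2) (max 0 (m x\<^sup>2 - 1) - 2 \<mu> x)\<close>. It decreases up to the kink \<open>x = 1 / sqrt m\<close> and is a
  convex parabola with vertex \<open>\<mu> / m\<close> beyond it. The three cases are a vertex at or beyond \<open>1\<close>,
  a vertex at or before the kink, and a vertex between the two.
\<close>

lemma B_L_lower:
  assumes \<alpha>: "0 < \<alpha>" and \<mu>: "0 < \<mu>" and x: "0 \<le> x" "x \<le> 1"
    and t: "0 \<le> t" "\<alpha> * cmod (3 - 4 * l) * x\<^sup>2 / 2 - (1 - x\<^sup>2) \<le> t"
  shows "B_L \<alpha> l \<mu> \<le> \<alpha> / 2 * t - \<mu> * (\<alpha> * x)"
proof -
  define K where "K = \<alpha> * cmod (3 - 4 * l)"
  define m where "m = (K + 2) / 2"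
  have Km: "K = 2 * m - 2" by (simp add: m_def field_simps)
  have m: "1 \<le> m" using \<alpha> by (simp add: m_def K_def)
  have tm: "m * x\<^sup>2 - 1 \<le> t"
    using t(2) unfolding K_def[symmetric] Km by (simp add: field_simps)
  have scale: ?thesis if "B_L \<alpha> l \<mu> = \<alpha> / 2 * b" "b \<le> t - 2 * \<mu> * x" for b
  proof -
    have "\<alpha> / 2 * b \<le> \<alpha> / 2 * (t - 2 * \<mu> * x)" using that \<alpha> by (intro mult_left_mono) auto
    then show ?thesis using that by (simp add: algebra_simps)
  qed
  consider "m \<le> \<mu>" | "\<mu> < m" "\<mu>\<^sup>2 \<le> m" | "\<mu> < m" "m < \<mu>\<^sup>2" by linarith
  then show ?thesis
  proof cases
    case 1
    have "m * (1 + x) \<le> m * 2" using x m by (intro mult_left_mono) auto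
    then have "0 \<le> (1 - x) * (2 * \<mu> - m * (1 + x))"
      using 1 x by (intro mult_nonneg_nonneg) auto
    then have "m - 1 - 2 * \<mu> \<le> t - 2 * \<mu> * x"
      using tm by (simp add: algebra_simps power2_eq_square)
    moreover have "B_L \<alpha> l \<mu> = \<alpha> / 2 * (m - 1 - 2 * \<mu>)"
      using 1 by (simp add: B_L_def Km flip: K_def) (simp add: field_simps)
    ultimately show ?thesis by (intro scale)
  next
    case 2
    \<comment> \<open>The bound \<open>\<mu> \<le> m * s\<close> below puts the vertex \<open>\<mu> / m\<close> at or before the kink \<open>s\<close>.\<close>
    define s where "s = sqrt (1 / m)"
    have s: "0 < s" and ms: "m * s\<^sup>2 = 1" using m by (simp_all add: s_def)
    have "(\<mu> * s)\<^sup>2 \<le> 1"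
      using mult_right_mono[OF 2(2), of "s\<^sup>2"] ms by (simp add: power_mult_distrib)
    then have "\<mu> * s \<le> 1" by (simp add: abs_square_le_1)
    then have "\<mu> * s \<le> m * s * s" using ms by (simp add: power2_eq_square)
    then have \<mu>ms: "\<mu> \<le> m * s" using s by simp
    have "- 2 * \<mu> * s \<le> t - 2 * \<mu> * x"
    proof (cases "x \<le> s")
      case True
      then have "\<mu> * x \<le> \<mu> * s" using \<mu> by simp
      then show ?thesis using t(1) by linarith
    next
      case False
      have "m * s \<le> m * x" using False m by simp
      then have "0 \<le> (x - s) * (m * (x + s) - 2 * \<mu>)"
        using False \<mu>ms by (intro mult_nonneg_nonneg) (auto simp: distrib_left)
      then have "0 \<le> m * x\<^sup>2 - m * s\<^sup>2 - 2 * \<mu> * x + 2 * \<mu> * s"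
        by (simp add: algebra_simps power2_eq_square)
      then show ?thesis using tm ms by linarith
    qed
    moreover have "B_L \<alpha> l \<mu> = \<alpha> / 2 * (- 2 * \<mu> * s)"
      using 2 m by (simp add: B_L_def Km s_def flip: K_def)
    ultimately show ?thesis by (intro scale)
  next
    case 3
    have "0 \<le> (m * x - \<mu>)\<^sup>2 / m" using m by simp
    also have "\<dots> = m * x\<^sup>2 - 2 * \<mu> * x + \<mu>\<^sup>2 / m"
      using m by (simp add: field_simps power2_eq_square)
    finally have "- 1 - \<mu>\<^sup>2 / m \<le> t - 2 * \<mu> * x" using tm by linarith
    moreover have "B_L \<alpha> l \<mu> = \<alpha> / 2 * (- 1 - \<mu>\<^sup>2 / m)"
      using 3 m by (simp add: B_L_def Km flip: K_def) (simp add: field_simps)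
    ultimately show ?thesis by (intro scale)
  qed
qed

text \<open>
  The witnesses \<open>1\<close>, \<open>1 / sqrt m\<close> and \<open>\<mu> / m\<close> all lie at or beyond the kink. There
  \<open>m x\<^sup>2 - 1\<close> is nonnegative, so it equals the modulus realised by an extremal function.
\<close>

lemma B_L_attained:
  assumes \<alpha>: "0 < \<alpha>" and \<mu>: "0 < \<mu>"
  obtains x where "0 \<le> x" "x \<le> 1" "1 - x\<^sup>2 \<le> \<alpha> * cmod (3 - 4 * l) * x\<^sup>2 / 2"
    "\<alpha> / 2 * (\<alpha> * cmod (3 - 4 * l) * x\<^sup>2 / 2 - (1 - x\<^sup>2)) - \<mu> * (\<alpha> * x) = B_L \<alpha> l \<mu>"
proof -
  define K where "K = \<alpha> * cmod (3 - 4 * l)"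
  define m where "m = (K + 2) / 2"
  have Km: "K = 2 * m - 2" by (simp add: m_def field_simps)
  have m: "1 \<le> m" using \<alpha> by (simp add: m_def K_def)
  note witness = that
  have *: thesis if "0 \<le> x" "x \<le> 1" "1 \<le> m * x\<^sup>2"
    "\<alpha> / 2 * (m * x\<^sup>2 - 1 - 2 * \<mu> * x) = B_L \<alpha> l \<mu>" for x
  proof (rule witness[of x])
    show "1 - x\<^sup>2 \<le> \<alpha> * cmod (3 - 4 * l) * x\<^sup>2 / 2"
      using that(3) unfolding K_def[symmetric] Km by (simp add: field_simps)
    show "\<alpha> / 2 * (\<alpha> * cmod (3 - 4 * l) * x\<^sup>2 / 2 - (1 - x\<^sup>2)) - \<mu> * (\<alpha> * x) = B_L \<alpha> l \<mu>"
      unfolding that(4)[symmetric] K_def[symmetric] Km by (simp add: field_simps)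
  qed (use that in auto)
  consider "m \<le> \<mu>" | "\<mu> < m" "\<mu>\<^sup>2 \<le> m" | "\<mu> < m" "m < \<mu>\<^sup>2" by linarith
  then show ?thesis
  proof cases
    case 1
    then have "B_L \<alpha> l \<mu> = \<alpha> / 2 * (m - 1 - 2 * \<mu>)"
      by (simp add: B_L_def Km flip: K_def) (simp add: field_simps)
    then show ?thesis using m by (intro *[of 1]) auto
  next
    case 2
    have "B_L \<alpha> l \<mu> = - \<alpha> * \<mu> * sqrt (1 / m)"
      using 2 m by (simp add: B_L_def Km flip: K_def)
    then show ?thesis using m by (intro *[of "sqrt (1 / m)"]) auto
  next
    case 3
    have "B_L \<alpha> l \<mu> = \<alpha> / 2 * (- 1 - \<mu>\<^sup>2 / m)"
      using 3 m by (simp add: B_L_def Km flip: K_def) (simp add: field_simps)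
    moreover have "m * (\<mu> / m)\<^sup>2 - 1 - 2 * \<mu> * (\<mu> / m) = - 1 - \<mu>\<^sup>2 / m"
      using m by (simp add: field_simps power2_eq_square)
    moreover have "1 \<le> m * (\<mu> / m)\<^sup>2"
      using 3 m by (simp add: field_simps power2_eq_square)
    ultimately show ?thesis using 3 m \<mu> by (intro *[of "\<mu> / m"]) auto
  qed
qed

section \<open>The sharp bounds\<close>

theorem theorem7p1:
  fixes \<alpha> \<mu> :: real and l :: complex
  assumes "0 < \<alpha>" and "\<alpha> \<le> 1" and "0 < \<mu>"
  shows "(\<forall>f\<in>class_S_ex \<alpha>.
            B_L \<alpha> l \<mu> \<le> cmod (taylor_coeff f 3 - l * (taylor_coeff f 2)\<^sup>2) - \<mu> * cmod (taylor_coeff f 2) \<and>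
            cmod (taylor_coeff f 3 - l * (taylor_coeff f 2)\<^sup>2) - \<mu> * cmod (taylor_coeff f 2) \<le> B_U \<alpha> l \<mu>) \<and>
         (\<exists>f\<in>class_S_ex \<alpha>.
            cmod (taylor_coeff f 3 - l * (taylor_coeff f 2)\<^sup>2) - \<mu> * cmod (taylor_coeff f 2) = B_U \<alpha> l \<mu>) \<and>
         (\<exists>f\<in>class_S_ex \<alpha>.
            cmod (taylor_coeff f 3 - l * (taylor_coeff f 2)\<^sup>2) - \<mu> * cmod (taylor_coeff f 2) = B_L \<alpha> l \<mu>)"
proof (intro conjI ballI)
  let ?J = "\<lambda>f. cmod (taylor_coeff f 3 - l * (taylor_coeff f 2)\<^sup>2) - \<mu> * cmod (taylor_coeff f 2)"
  let ?K = "\<alpha> * cmod (3 - 4 * l)"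
  fix f assume "f \<in> class_S_ex \<alpha>"
  then obtain c d where d: "cmod d \<le> 1 - (cmod c)\<^sup>2"
    and coeffs: "taylor_coeff f 2 = of_real \<alpha> * c"
    "taylor_coeff f 3 = of_real \<alpha> * d / 2 + 3 * (of_real \<alpha>)\<^sup>2 * c\<^sup>2 / 4"
    by (rule class_S_ex_coeffs)
  define x where "x = cmod c"
  define e where "e = of_real \<alpha> * (3 - 4 * l) * c\<^sup>2 / 2"
  have d: "cmod d \<le> 1 - x\<^sup>2" using d by (simp add: x_def)
  have e: "cmod e = ?K * x\<^sup>2 / 2"
    using assms by (simp add: e_def x_def norm_mult norm_divide norm_power)
  have "x\<^sup>2 \<le> 1" using d norm_ge_zero[of d] by linarith
  then have x: "0 \<le> x" "x \<le> 1" by (auto simp: x_def abs_square_le_1)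
  have J: "?J f = \<alpha> / 2 * cmod (d + e) - \<mu> * (\<alpha> * x)"
    unfolding coeffs e_def using assms
    by (subst fekete_szego_combination) (auto simp: norm_mult x_def)
  have "cmod e - cmod d \<le> cmod (d + e)"
    using norm_diff_ineq[of e d] by (simp add: add.commute)
  then have "?K * x\<^sup>2 / 2 - (1 - x\<^sup>2) \<le> cmod (d + e)" using d e by linarith
  from B_L_lower[OF assms(1,3) x norm_ge_zero this]
  show "B_L \<alpha> l \<mu> \<le> ?J f" unfolding J .
  have "cmod (d + e) \<le> 1 - x\<^sup>2 + ?K * x\<^sup>2 / 2"
    using norm_triangle_ineq[of d e] d e by linarith
  then have "\<alpha> / 2 * cmod (d + e) \<le> \<alpha> / 2 * (1 - x\<^sup>2 + ?K * x\<^sup>2 / 2)"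
    using assms(1) by (intro mult_left_mono) auto
  then show "?J f \<le> B_U \<alpha> l \<mu>"
    unfolding J using B_U_upper[OF assms(1,3) x, of l] by linarith
next
  let ?J = "\<lambda>f. cmod (taylor_coeff f 3 - l * (taylor_coeff f 2)\<^sup>2) - \<mu> * cmod (taylor_coeff f 2)"
  let ?K = "\<alpha> * cmod (3 - 4 * l)"
  have nonneg: "0 \<le> \<alpha>" using assms by simp
  show "\<exists>f\<in>class_S_ex \<alpha>. ?J f = B_U \<alpha> l \<mu>"
  proof (cases "?K < 2 + 4 * \<mu>")
    case True
    obtain f where "f \<in> class_S_ex \<alpha>"
      "?J f = \<alpha> / 2 * \<bar>?K * 0\<^sup>2 / 2 - (1 - 0\<^sup>2)\<bar> - \<mu> * (\<alpha> * 0)"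
      by (rule class_S_ex_functional_attained[OF nonneg, of 0 l]) auto
    then show ?thesis using True by (intro bexI[of _ f]) (simp_all add: B_U_def)
  next
    case False
    obtain f where "f \<in> class_S_ex \<alpha>"
      "?J f = \<alpha> / 2 * \<bar>?K * 1\<^sup>2 / 2 - (1 - 1\<^sup>2)\<bar> - \<mu> * (\<alpha> * 1)"
      by (rule class_S_ex_functional_attained[OF nonneg, of 1 l]) auto
    then show ?thesis
      using False nonneg
      by (intro bexI[of _ f]) (simp_all add: B_U_def abs_mult power2_eq_square field_simps)
  qed
  obtain x where x: "0 \<le> x" "x \<le> 1" "1 - x\<^sup>2 \<le> ?K * x\<^sup>2 / 2"
    "\<alpha> / 2 * (?K * x\<^sup>2 / 2 - (1 - x\<^sup>2)) - \<mu> * (\<alpha> * x) = B_L \<alpha> l \<mu>"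
    using B_L_attained[OF assms(1,3), of l] by blast
  obtain f where "f \<in> class_S_ex \<alpha>"
    "?J f = \<alpha> / 2 * \<bar>?K * x\<^sup>2 / 2 - (1 - x\<^sup>2)\<bar> - \<mu> * (\<alpha> * x)"
    by (rule class_S_ex_functional_attained[OF nonneg x(1,2), of l])
  then show "\<exists>f\<in>class_S_ex \<alpha>. ?J f = B_L \<alpha> l \<mu>"
    using x(3,4) by (intro bexI[of _ f]) simp_all
qed

end
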